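(* For each fixed $L\in\mathbb{N}_+$ with $L<N$ and any $0\le\ell\le L$, the following hold for the process $\mathrm{PMM}_L(\ell)$ on $\mathbb{T}_N$ (with constraint $\mathbf{p}_{\ell;L}$). (i) Mobile clusters: any box of length $L+2$ with at least $\ell+1$ particles and at least one vacant site is a mobile cluster. (ii) There are blocked configurations. (iii) Interpolation: $\mathrm{PMM}_L(L)=\mathrm{PMM}(L)$. (iv) Range: for each $\eta\in\Omega_N$, $\mathbf{p}_{\ell;L}(\eta)\in[0,1]$. (v) Monotonicity: the sequence $(\mathbf{p}_{\ell;L})_{0\le\ell\le L}$ is non-increasing. (vi) Equilibrium expected value: for any $\rho\in[0,1]$, $\displaystyle\int_{\Omega_N}\mathbf{p}_{\ell;L}\,\mathrm{d}\nu_\rho^N=\rho^\ell$.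
   Context: $N\in\mathbb{N}_+$ is fixed, $\mathbb{T}_N=\mathbb{Z}/N\mathbb{Z}$ is the one-dimensional discrete torus and $\Omega_N=\{0,1\}^{\mathbb{T}_N}$; $\eta(x)\in\{0,1\}$ is the occupation value of $\eta$ at $x$ ($1$ = particle, $0$ = vacant site, also called hole). The shift is $(\tau\eta)(x)=\eta(x+1)$, with iterates $\tau^x$. For sites $x,y$, $\theta_{x,y}\eta$ is $\eta$ with the occupation values at $x$ and $y$ exchanged, and $\nabla_{x,y}[f](\eta)=f(\theta_{x,y}\eta)-f(\eta)$ for $f:\Omega_N\to\mathbb{R}$. For $\rho\in[0,1]$, $\nu_\rho^N$ is the Bernoulli product measure on $\Omega_N$ with $\nu_\rho^N(\eta(x)=1)=\rho$ for every $x\in\mathbb{T}_N$. A constraint $\mathbf{c}:\Omega_N\to[0,\infty)$ defines the process with Markov generator $$\mathcal{L}_N[f](\eta)=\sum_{x\in\mathbb{T}_N}\mathbf{c}(\tau^x\eta)\,\nabla_{x,x+1}[f](\eta),$$ and each such process is identified with its constraint. $\mathrm{PMM}(n)$ (Porous Media Model), $n\in\mathbb{N}_+$, is the process with $\mathbf{c}=\mathbf{c}^n$, where $$\mathbf{c}^n(\eta)=\frac{1}{n+1}\sum_{j=1}^{n+1}\ \prod_{\substack{i=-(n+1)+j\\ i\ne0,1}}^{j}\eta(i).$$ $\mathrm{PMM}_L(\ell)$ (reduced Porous Media Model), $0\le\ell\le L<N$, is the process with $\mathbf{c}=\mathbf{p}_{\ell;L}$, where, with $W_j^L=\{-j,-j+1,\dots,-j+L+1\}\setminus\{0,1\}$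 (viewed in $\mathbb{T}_N$) and $m_j^L(\eta)$ the number of particles of $\eta$ in $W_j^L$, $$\mathbf{p}_{\ell;L}=\frac{1}{L+1}\sum_{j=0}^{L}\mathbf{p}_{\ell;L}^j,\qquad \mathbf{p}_{\ell;L}^j(\eta)=\frac{\binom{m_j^L(\eta)}{\ell}}{\binom{L}{\ell}}\,\mathbf{1}\{m_j^L(\eta)\ge\ell\}.$$ Blocked configuration: a configuration $\eta\in\Omega_N$ such that the constraint of the process, here $\mathbf{p}_{\ell;L}$, satisfies $\mathbf{p}_{\ell;L}(\tau^x\eta)=0$ for every $x\in\mathbb{T}_N$. Mobile cluster: a jump in the node $\{x,x+1\}$ is the exchange of the occupation values of $x$ and $x+1$ when these differ; it is possible in $\eta$ if $\mathbf{c}(\tau^x\eta)>0$. Let $\blacksquare$ represent a fixed finite box (a pattern on consecutive sites) composed of particles and vacant sites, and write $\bullet$ for a particle and $\circ$ for a hole. The box $\blacksquare$ is a mobile cluster if it enjoys the following. - Mobility: the transitions $\blacksquare\bullet\leftrightarrow\bullet\blacksquare$ and $\blacksquare\circ\leftrightarrow\circ\blacksquare$ are possible with a finite number of jumps, independently of the rest of the configuration. - Mass transport: it is always possible for a jump to occur in a node if there exists a cluster in the vicinity of that node, that is, the transitions $\blacksquare\circ\bullet\leftrightarrow\blacksquare\bullet\circ$ and $\circ\bullet\blacksquare\leftrightarrow\bullet\circ\blacksquare$ are possible.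
   Formalization: (ii) is stated for ℓ≥1 only (for ℓ=0 the constraint is identically 1, so nothing is blocked); (vi) excludes N=L+1 with ℓ≥2, where a window wraps onto the same site and the expectation is not ρ^ℓ. For N=L+1 a doubled site in a window is counted twice. *)

theory Defs
  imports "HOL-Probability.Probability" "Berlekamp_Zassenhaus.Finite_Field"
begin

text \<open>The torus is the ring \<open>'n mod_ring\<close> of integers modulo \<open>N = CARD('n)\<close>; the class
  \<open>nontriv\<close> only asks for \<open>N > 1\<close>. A configuration sends a site to \<open>True\<close> (a particle, value 1)
  or to \<open>False\<close> (a hole, value 0).\<close>

type_synonym 'n config = "'n mod_ring \<Rightarrow> bool"

type_synonym 'n constraint = "'n config \<Rightarrow> real"

definition translate :: "'n::nontriv mod_ring \<Rightarrow> 'n config \<Rightarrow> 'n config" where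
  "translate x \<eta> = (\<lambda>y. \<eta> (y + x))"

text \<open>\<open>translate x\<close> is the iterate of order \<open>x\<close> of the shift \<open>translate 1\<close>.\<close>

lemma translate_of_nat: "translate (of_nat k) \<eta> = (translate 1 ^^ k) \<eta>"
proof (induction k)
  case 0
  show ?case by (simp add: translate_def)
next
  case (Suc k)
  have "translate (of_nat (Suc k)) \<eta> = translate 1 (translate (of_nat k) \<eta>)"
    by (simp add: translate_def add_ac)
  then show ?case using Suc by simp
qed

definition exchange :: "'n::nontriv mod_ring \<Rightarrow> 'n mod_ring \<Rightarrow> 'n config \<Rightarrow> 'n config" where
  "exchange x y \<eta> = \<eta>(x := \<eta> y, y := \<eta> x)"

definition bernoulli_measure :: "real \<Rightarrow> ('n::nontriv config) measure" where
  "bernoulli_measure \<rho> = (\<Pi>\<^sub>M x\<in>(UNIV :: 'n mod_ring set). measure_pmf (bernoulli_pmf \<rho>))"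


text \<open>A process is identified with its constraint. Indices are integers, excluded at 0 and 1
  as integers, and are reduced modulo \<open>N\<close> only where the configuration is evaluated.\<close>

definition pmm :: "nat \<Rightarrow> 'n::nontriv constraint" where
  "pmm n \<eta> = 1 / real (n + 1) *
    (\<Sum>j = 1..n + 1. \<Prod>i \<in> {- (int n + 1) + int j..int j} - {0, 1}. of_bool (\<eta> (of_int i)))"

definition window :: "nat \<Rightarrow> nat \<Rightarrow> int set" where
  "window L j = {- int j..- int j + int L + 1} - {0, 1}"

definition window_particles :: "nat \<Rightarrow> nat \<Rightarrow> 'n::nontriv config \<Rightarrow> nat" where
  "window_particles L j \<eta> = card {i \<in> window L j. \<eta> (of_int i)}"

definition reduced_pmm_window :: "nat \<Rightarrow> nat \<Rightarrow> nat \<Rightarrow> 'n::nontriv constraint" where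
  "reduced_pmm_window l L j \<eta> =
    real (window_particles L j \<eta> choose l) / real (L choose l) *
    of_bool (l \<le> window_particles L j \<eta>)"

definition reduced_pmm :: "nat \<Rightarrow> nat \<Rightarrow> 'n::nontriv constraint" where
  "reduced_pmm l L \<eta> = 1 / real (L + 1) * (\<Sum>j = 0..L. reduced_pmm_window l L j \<eta>)"


definition blocked :: "'n::nontriv constraint \<Rightarrow> 'n config \<Rightarrow> bool" where
  "blocked c \<eta> \<longleftrightarrow> (\<forall>x. c (translate x \<eta>) = 0)"

definition jump ::
    "'n::nontriv constraint \<Rightarrow> 'n mod_ring \<Rightarrow> 'n config \<Rightarrow> 'n config \<Rightarrow> bool" where
  "jump c x \<eta> \<eta>' \<longleftrightarrow> \<eta> x \<noteq> \<eta> (x + 1) \<and> c (translate x \<eta>) > 0 \<and> \<eta>' = exchange x (x + 1) \<eta>"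

fun jumps ::
    "'n::nontriv constraint \<Rightarrow> 'n mod_ring list \<Rightarrow> 'n config \<Rightarrow> 'n config \<Rightarrow> bool" where
  "jumps c [] \<eta> \<eta>' \<longleftrightarrow> \<eta>' = \<eta>"
| "jumps c (x # xs) \<eta> \<eta>' \<longleftrightarrow> (\<exists>\<zeta>. jump c x \<eta> \<zeta> \<and> jumps c xs \<zeta> \<eta>')"

text \<open>A box, or pattern, is a list of occupation values. It occupies consecutive sites that are
  pairwise distinct, so it only occurs on a torus with at least as many sites as it has.\<close>

definition occurs_at :: "bool list \<Rightarrow> 'n::nontriv mod_ring \<Rightarrow> 'n config \<Rightarrow> bool" where
  "occurs_at P x \<eta> \<longleftrightarrow>
    length P \<le> CARD('n) \<and> (\<forall>i < length P. \<eta> (x + of_nat i) = P ! i)"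

text \<open>The finite sequence of nodes is chosen before \<open>\<eta>\<close>: it depends on the patterns and their
  location, but not on the rest of the configuration, which is left unchanged.\<close>

definition transition_possible ::
    "'n::nontriv constraint \<Rightarrow> bool list \<Rightarrow> bool list \<Rightarrow> bool" where
  "transition_possible c P Q \<longleftrightarrow> length P = length Q \<and>
    (\<forall>x. \<exists>xs. \<forall>\<eta>. occurs_at P x \<eta> \<longrightarrow>
      (\<exists>\<eta>'. jumps c xs \<eta> \<eta>' \<and> occurs_at Q x \<eta>' \<and>
        (\<forall>y. y \<notin> (\<lambda>i. x + of_nat i) ` {..<length P} \<longrightarrow> \<eta>' y = \<eta> y)))"

definition transitions_possible ::
    "'n::nontriv constraint \<Rightarrow> bool list \<Rightarrow> bool list \<Rightarrow> bool" where
  "transitions_possible c P Q \<longleftrightarrow> transition_possible c P Q \<and> transition_possible c Q P"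

definition mobile_cluster :: "'n::nontriv constraint \<Rightarrow> bool list \<Rightarrow> bool" where
  "mobile_cluster c B \<longleftrightarrow>
    transitions_possible c (B @ [True]) ([True] @ B) \<and>
    transitions_possible c (B @ [False]) ([False] @ B) \<and>
    transitions_possible c (B @ [False, True]) (B @ [True, False]) \<and>
    transitions_possible c ([False, True] @ B) ([True, False] @ B)"

end

theory Submission
  imports Defs
begin

text \<open>A node whose occupation values differ holds exactly one particle. Inside a box of length
  \<open>L + 2\<close> with at least \<open>l + 1\<close> particles, each such node therefore sees \<open>l\<close> particles in the rest of
  the box, which is a window of the constraint. So the contents of the box can be permuted freely.
  Bringing a hole of the box to one of its ends, where it leaves the box, makes every shifted box
  that is needed rich enough as well, whether the neighbouring site is occupied or not.

  For the expectation, \<open>m choose l\<close> counts the \<open>l\<close>-subsets of the window that are fully occupied, and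
  each of them is occupied with probability \<open>\<rho> ^ l\<close>.\<close>

section \<open>Permuting a list by adjacent swaps\<close>

text \<open>Selection sort: the head of \<open>ys\<close> is bubbled to the front of
  \<open>xs\<close>, then the tails are treated alike. Every intermediate list has multiset
  \<open>M\<close>; for boxes this fixes the particle count and keeps each swap legal.\<close>

lemma adjacent_swaps_mset:
  assumes refl: "\<And>zs. mset zs = M \<Longrightarrow> R zs zs"
    and trans: "\<And>us vs ws. R us vs \<Longrightarrow> R vs ws \<Longrightarrow> R us ws"
    and swap: "\<And>as x y bs. mset (as @ [x, y] @ bs) = M \<Longrightarrow>
      R (as @ [x, y] @ bs) (as @ [y, x] @ bs)"
    and "mset xs = M" and "mset ys = M"
  shows "R xs ys"
proof -
  \<comment> \<open>\<open>y\<close> travels left across \<open>us\<close>; the induction runs from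
    the right end, whose entry is adjacent to \<open>y\<close>.\<close>
  have move: "R (ps @ us @ y # vs) (ps @ y # us @ vs)"
    if "mset (ps @ us @ y # vs) = M" for ps us y vs
    using that
  proof (induction us arbitrary: vs rule: rev_induct)
    case Nil
    then show ?case using refl by simp
  next
    case (snoc u us)
    have "R (ps @ (us @ [u]) @ y # vs) (ps @ us @ y # u # vs)"
      using swap[of "ps @ us" u y vs] snoc.prems by simp
    moreover have "R (ps @ us @ y # u # vs) (ps @ y # us @ u # vs)"
      using snoc.prems by (intro snoc.IH) (simp add: add_mset_commute)
    ultimately show ?case using trans by simp
  qed
  \<comment> \<open>\<open>ps\<close> is the part already in order, kept general so that it can
    absorb \<open>y\<close>.\<close>
  have "R (ps @ xs) (ps @ ys)" if "mset xs = mset ys" "mset (ps @ xs) = M" for ps xs ys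
    using that
  proof (induction ys arbitrary: ps xs)
    case Nil
    then show ?case using refl by simp
  next
    case (Cons y ys)
    have "y \<in> set xs"
      using mset_eq_setD[OF Cons.prems(1)] by simp
    then obtain us vs where xs: "xs = us @ y # vs"
      by (auto dest: split_list)
    have "R (ps @ xs) (ps @ y # us @ vs)"
      using move Cons.prems xs by simp
    moreover have "R ((ps @ [y]) @ us @ vs) ((ps @ [y]) @ ys)"
      using Cons.prems xs by (intro Cons.IH) auto
    ultimately show ?case using trans by simp
  qed
  from this[of xs ys "[]"] show ?thesis using assms(4,5) by simp
qed

lemma mset_bool_eqI:
  fixes P Q :: "bool list"
  assumes "length P = length Q" and "count_list P True = count_list Q True"
  shows "mset P = mset Q"
proof (rule multiset_eqI)
  have *: "count_list zs False = length zs - count_list zs True" for zs :: "bool list"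
  proof -
    have "count_list zs True + count_list zs False = length zs"
      by (induction zs) auto
    then show ?thesis by simp
  qed
  fix b
  show "count (mset P) b = count (mset Q) b"
    by (cases b) (use assms * in \<open>simp_all add: count_mset\<close>)
qed

lemma prod_of_bool:
  assumes "finite I"
  shows "(\<Prod>i \<in> I. of_bool (p i)) = (of_bool (\<forall>i \<in> I. p i) :: 'a :: semidom)"
  using assms by (induction I rule: finite_induct) auto

lemma count_list_True_card: "count_list P True = card {i. i < length P \<and> P ! i}"
proof -
  have "count_list P True = length (filter id P)"
    by (induction P) auto
  then show ?thesis by (simp add: length_filter_conv_card)
qed

section \<open>Transitions between patterns\<close>

text \<open>Equal residues differ by a multiple of \<open>CARD('n)\<close>, while two points of the
  interval differ by less. This carries counts of integer indices over to sites.\<close>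

lemma inj_on_of_int_mod_ring:
  assumes "b - a < int CARD('n::nontriv)"
  shows "inj_on (of_int :: int \<Rightarrow> 'n mod_ring) {a..b}"
proof (rule inj_onI)
  fix i j assume ij: "i \<in> {a..b}" "j \<in> {a..b}" and eq: "(of_int i :: 'n mod_ring) = of_int j"
  from eq have "i mod int CARD('n) = j mod int CARD('n)"
    by transfer
  then have "int CARD('n) dvd i - j"
    by (simp add: mod_eq_dvd_iff)
  moreover have "\<bar>i - j\<bar> < int CARD('n)"
    using ij assms by auto
  ultimately show "i = j"
    using dvd_imp_le_int[of "i - j" "int CARD('n)"] by fastforce
qed

lemma site_eq_iff:
  assumes "i < CARD('n::nontriv)" and "j < CARD('n)"
  shows "x + of_nat i = x + (of_nat j :: 'n mod_ring) \<longleftrightarrow> i = j"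
proof -
  have "inj_on (of_int :: int \<Rightarrow> 'n mod_ring) {0..int CARD('n) - 1}"
    by (rule inj_on_of_int_mod_ring) simp
  from inj_on_eq_iff[OF this, of "int i" "int j"] show ?thesis
    using assms by simp
qed

lemma jumps_append:
  "jumps c (xs @ ys) \<eta> \<eta>' \<longleftrightarrow> (\<exists>\<zeta>. jumps c xs \<eta> \<zeta> \<and> jumps c ys \<zeta> \<eta>')"
  by (induction xs arbitrary: \<eta>) auto

lemma transition_possible_refl: "transition_possible c P P"
  unfolding transition_possible_def by (auto intro: exI[of _ "[]"])

text \<open>Concatenate the node lists: both are fixed before the configuration, so the result is
  too.\<close>

lemma transition_possible_trans:
  assumes PQ: "transition_possible c P Q" and QR: "transition_possible c Q R"
  shows "transition_possible c P R"
  unfolding transition_possible_def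
proof (intro conjI allI)
  show "length P = length R"
    using assms by (simp add: transition_possible_def)
  fix x
  from PQ obtain xs where xs: "\<And>\<eta>. occurs_at P x \<eta> \<Longrightarrow>
      \<exists>\<eta>'. jumps c xs \<eta> \<eta>' \<and> occurs_at Q x \<eta>' \<and>
        (\<forall>y. y \<notin> (\<lambda>i. x + of_nat i) ` {..<length P} \<longrightarrow> \<eta>' y = \<eta> y)"
    unfolding transition_possible_def by blast
  from QR obtain ys where ys: "\<And>\<eta>. occurs_at Q x \<eta> \<Longrightarrow>
      \<exists>\<eta>'. jumps c ys \<eta> \<eta>' \<and> occurs_at R x \<eta>' \<and>
        (\<forall>y. y \<notin> (\<lambda>i. x + of_nat i) ` {..<length Q} \<longrightarrow> \<eta>' y = \<eta> y)"
    unfolding transition_possible_def by blast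
  have len: "length P = length Q"
    using PQ by (simp add: transition_possible_def)
  show "\<exists>zs. \<forall>\<eta>. occurs_at P x \<eta> \<longrightarrow> (\<exists>\<eta>'. jumps c zs \<eta> \<eta>' \<and> occurs_at R x \<eta>' \<and>
        (\<forall>y. y \<notin> (\<lambda>i. x + of_nat i) ` {..<length P} \<longrightarrow> \<eta>' y = \<eta> y))"
  proof (intro exI[of _ "xs @ ys"] allI impI)
    fix \<eta> assume "occurs_at P x \<eta>"
    then obtain \<zeta> where \<zeta>: "jumps c xs \<eta> \<zeta>" "occurs_at Q x \<zeta>"
        "\<forall>y. y \<notin> (\<lambda>i. x + of_nat i) ` {..<length P} \<longrightarrow> \<zeta> y = \<eta> y"
      using xs by blast
    then obtain \<eta>' where \<eta>': "jumps c ys \<zeta> \<eta>'" "occurs_at R x \<eta>'"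
        "\<forall>y. y \<notin> (\<lambda>i. x + of_nat i) ` {..<length Q} \<longrightarrow> \<eta>' y = \<zeta> y"
      using ys by blast
    have "jumps c (xs @ ys) \<eta> \<eta>'"
      using \<zeta>(1) \<eta>'(1) by (auto simp: jumps_append)
    moreover have "\<forall>y. y \<notin> (\<lambda>i. x + of_nat i) ` {..<length P} \<longrightarrow> \<eta>' y = \<eta> y"
      using \<zeta>(3) \<eta>'(3) len by simp
    ultimately show "\<exists>\<eta>'. jumps c (xs @ ys) \<eta> \<eta>' \<and> occurs_at R x \<eta>' \<and>
        (\<forall>y. y \<notin> (\<lambda>i. x + of_nat i) ` {..<length P} \<longrightarrow> \<eta>' y = \<eta> y)"
      using \<eta>'(2) by blast
  qed
qed

text \<open>The node list for \<open>P\<close> is reused at its position in the larger pattern.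
  Sites outside \<open>P\<close> stay unchanged, hence \<open>A\<close> and \<open>B\<close> do,
  since a pattern that fits on the torus occupies distinct sites.\<close>

lemma transition_possible_context:
  fixes c :: "'n::nontriv constraint"
  assumes PQ: "transition_possible c P Q"
  shows "transition_possible c (A @ P @ B) (A @ Q @ B)"
  unfolding transition_possible_def
proof (intro conjI allI)
  have len: "length P = length Q"
    using PQ by (simp add: transition_possible_def)
  then show "length (A @ P @ B) = length (A @ Q @ B)"
    by simp
  fix x :: "'n mod_ring"
  define z where "z = x + of_nat (length A)"
  from PQ obtain xs where xs: "\<And>\<eta>. occurs_at P z \<eta> \<Longrightarrow>
      \<exists>\<eta>'. jumps c xs \<eta> \<eta>' \<and> occurs_at Q z \<eta>' \<and>
        (\<forall>y. y \<notin> (\<lambda>i. z + of_nat i) ` {..<length P} \<longrightarrow> \<eta>' y = \<eta> y)"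
    unfolding transition_possible_def by blast
  have z: "z + of_nat i = x + of_nat (length A + i)" for i
    by (simp add: z_def add.assoc)
  show "\<exists>zs. \<forall>\<eta>. occurs_at (A @ P @ B) x \<eta> \<longrightarrow>
      (\<exists>\<eta>'. jumps c zs \<eta> \<eta>' \<and> occurs_at (A @ Q @ B) x \<eta>' \<and>
        (\<forall>y. y \<notin> (\<lambda>i. x + of_nat i) ` {..<length (A @ P @ B)} \<longrightarrow> \<eta>' y = \<eta> y))"
  proof (intro exI[of _ xs] allI impI)
    fix \<eta> assume occ: "occurs_at (A @ P @ B) x \<eta>"
    then have card: "length (A @ P @ B) \<le> CARD('n)"
      and val: "\<And>i. i < length (A @ P @ B) \<Longrightarrow> \<eta> (x + of_nat i) = (A @ P @ B) ! i"
      by (auto simp: occurs_at_def)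
    have "occurs_at P z \<eta>"
      unfolding occurs_at_def z
    proof (intro conjI allI impI)
      show "length P \<le> CARD('n)"
        using card by simp
      fix i assume "i < length P"
      then show "\<eta> (x + of_nat (length A + i)) = P ! i"
        by (subst val) (auto simp: nth_append)
    qed
    then obtain \<eta>' where \<eta>': "jumps c xs \<eta> \<eta>'" "occurs_at Q z \<eta>'"
        "\<And>y. y \<notin> (\<lambda>i. z + of_nat i) ` {..<length P} \<Longrightarrow> \<eta>' y = \<eta> y"
      using xs by blast
    have "occurs_at (A @ Q @ B) x \<eta>'"
      unfolding occurs_at_def
    proof (intro conjI allI impI)
      show "length (A @ Q @ B) \<le> CARD('n)"
        using card len by simp
      fix i assume i: "i < length (A @ Q @ B)"
      show "\<eta>' (x + of_nat i) = (A @ Q @ B) ! i"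
      proof (cases "length A \<le> i \<and> i < length A + length P")
        case True
        then obtain k where k: "i = length A + k" "k < length Q"
          using len by (metis add_less_cancel_left le_Suc_ex)
        then have "\<eta>' (x + of_nat i) = Q ! k"
          using \<eta>'(2) by (simp add: occurs_at_def z)
        then show ?thesis
          using k by (simp add: nth_append)
      next
        case False
        have "x + of_nat i \<noteq> x + of_nat (length A + k)" if "k < length P" for k
          using False i that card len
          by (subst site_eq_iff) auto
        then have "\<eta>' (x + of_nat i) = \<eta> (x + of_nat i)"
          by (intro \<eta>'(3)) (auto simp: z)
        also have "\<dots> = (A @ P @ B) ! i"
          using val i len by simp
        also have "\<dots> = (A @ Q @ B) ! i"
          using False len by (auto simp: nth_append)
        finally show ?thesis .
      qed
    qed
    moreover have "\<eta>' y = \<eta> y"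
      if "y \<notin> (\<lambda>i. x + of_nat i) ` {..<length (A @ P @ B)}" for y
    proof (rule \<eta>'(3))
      have "(\<lambda>i. z + of_nat i) ` {..<length P}
          \<subseteq> (\<lambda>i. x + of_nat i) ` {..<length (A @ P @ B)}"
        unfolding z by (intro image_subsetI imageI) simp
      then show "y \<notin> (\<lambda>i. z + of_nat i) ` {..<length P}"
        using that by blast
    qed
    ultimately show "\<exists>\<eta>'. jumps c xs \<eta> \<eta>' \<and> occurs_at (A @ Q @ B) x \<eta>' \<and>
        (\<forall>y. y \<notin> (\<lambda>i. x + of_nat i) ` {..<length (A @ P @ B)} \<longrightarrow> \<eta>' y = \<eta> y)"
      using \<eta>'(1) by blast
  qed
qed

lemma transitions_possible_sym: "transitions_possible c P Q \<Longrightarrow> transitions_possible c Q P"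
  by (simp add: transitions_possible_def)

lemma transitions_possible_trans [trans]:
  "transitions_possible c P Q \<Longrightarrow> transitions_possible c Q R \<Longrightarrow> transitions_possible c P R"
  by (auto simp: transitions_possible_def intro: transition_possible_trans)

lemma transitions_possible_context:
  "transitions_possible c P Q \<Longrightarrow> transitions_possible c (A @ P @ B) (A @ Q @ B)"
  by (simp add: transitions_possible_def transition_possible_context)

section \<open>Mobile clusters\<close>

lemma finite_window [simp]: "finite (window L j)"
  by (simp add: window_def)

lemma card_window:
  assumes "j \<le> L"
  shows "card (window L j) = L"
  using assms by (simp add: window_def card_Diff_subset)

lemma window_particles_le: "j \<le> L \<Longrightarrow> window_particles L j \<eta> \<le> L"
  using card_mono[of "window L j" "{i \<in> window L j. \<eta> (of_int i)}"]
  by (auto simp: window_particles_def card_window)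

lemma reduced_pmm_window_eq:
  "reduced_pmm_window l L j \<eta> = real (window_particles L j \<eta> choose l) / real (L choose l)"
  by (cases "l \<le> window_particles L j \<eta>") (simp_all add: reduced_pmm_window_def)

lemma reduced_pmm_window_nonneg: "0 \<le> reduced_pmm_window l L j \<eta>"
  by (simp add: reduced_pmm_window_def)

text \<open>All windows contribute non-negatively, so one well-filled window makes the average
  positive. A window has \<open>L\<close> indices, which forces \<open>l \<le> L\<close> and keeps
  \<open>L choose l\<close> positive.\<close>

lemma reduced_pmm_pos:
  assumes "j \<le> L" and "l \<le> window_particles L j \<eta>"
  shows "0 < reduced_pmm l L \<eta>"
proof -
  have "l \<le> L"
    using window_particles_le[OF assms(1), of \<eta>] assms(2) by simp
  then have "0 < reduced_pmm_window l L j \<eta>"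
    using assms by (simp add: reduced_pmm_window_def)
  then have "0 < (\<Sum>j = 0..L. reduced_pmm_window l L j \<eta>)"
    using assms(1) by (intro sum_pos2[of _ j]) (auto simp: reduced_pmm_window_nonneg)
  then show ?thesis
    by (simp add: reduced_pmm_def)
qed

text \<open>Moving the node at positions \<open>j\<close>, \<open>j + 1\<close> to 0, 1 sends
  position \<open>i\<close> to \<open>i - j\<close>, so the rest of the box becomes exactly
  \<open>window L j\<close>. The \<open>+ 1\<close> is the one particle in the node, at position
  \<open>k\<close> below.\<close>

lemma window_particles_occurs_at:
  assumes occ: "occurs_at P x \<eta>" and len: "length P = L + 2"
    and j: "j \<le> L" and ne: "P ! j \<noteq> P ! (j + 1)"
  shows "count_list P True \<le> window_particles L j (translate (x + of_nat j) \<eta>) + 1"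
proof -
  define S where "S = {i. i < length P \<and> P ! i}"
  define k where "k = (if P ! j then j else j + 1)"
  have fin: "finite S"
    by (simp add: S_def)
  have "card (S - {k}) = card ((\<lambda>i. int i - int j) ` (S - {k}))"
    by (rule card_image[symmetric]) (auto simp: inj_on_def)
  also have "\<dots> \<le> window_particles L j (translate (x + of_nat j) \<eta>)"
    unfolding window_particles_def
  proof (rule card_mono)
    show "(\<lambda>i. int i - int j) ` (S - {k})
      \<subseteq> {i \<in> window L j. translate (x + of_nat j) \<eta> (of_int i)}"
    proof (rule image_subsetI)
      fix i assume i: "i \<in> S - {k}"
      then have "i \<noteq> j" "i \<noteq> j + 1" "i < L + 2"
        using ne len by (auto simp: S_def k_def split: if_splits)
      then have "int i - int j \<in> window L j"
        by (auto simp: window_def)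
      moreover have "\<eta> (x + of_nat i)"
        using i occ by (simp add: S_def occurs_at_def)
      then have "translate (x + of_nat j) \<eta> (of_int (int i - int j))"
        by (simp add: translate_def add.commute)
      ultimately show "int i - int j \<in> {i \<in> window L j. translate (x + of_nat j) \<eta> (of_int i)}"
        by simp
    qed
  qed simp
  finally have "card (S - {k}) \<le> window_particles L j (translate (x + of_nat j) \<eta>)" .
  moreover have "card S \<le> card (S - {k}) + 1"
    using fin by (metis One_nat_def card_Diff1_le card_Diff_singleton_if diff_le_self le_diff_conv order_refl)
  ultimately show ?thesis
    by (simp add: count_list_True_card S_def)
qed

text \<open>At most a single jump: of at least \<open>l + 1\<close> particles one sits in the node,
  which leaves \<open>l\<close> in the window with index \<open>length A\<close>.\<close>

lemma transition_possible_swap: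
  assumes len: "length (A @ [u, v] @ B) = L + 2"
    and cnt: "l + 1 \<le> count_list (A @ [u, v] @ B) True"
  shows "transition_possible (reduced_pmm l L :: 'n::nontriv constraint)
    (A @ [u, v] @ B) (A @ [v, u] @ B)"
\<comment> \<open>Equal values allow no jump, but then the patterns coincide and the empty node list
  serves.\<close>
proof (cases "u = v")
  case True
  then show ?thesis
    by (simp add: transition_possible_refl)
next
  case False
  define j where "j = length A"
  let ?P = "A @ [u, v] @ B" and ?Q = "A @ [v, u] @ B"
  have jL: "j \<le> L"
    using len by (simp add: j_def)
  have Pj: "?P ! j = u" "?P ! (j + 1) = v"
    by (simp_all add: j_def nth_append)
  show ?thesis
    unfolding transition_possible_def
  proof (intro conjI allI)
    show "length ?P = length ?Q"
      by simp
    fix x :: "'n mod_ring"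
    show "\<exists>xs. \<forall>\<eta>. occurs_at ?P x \<eta> \<longrightarrow>
      (\<exists>\<eta>'. jumps (reduced_pmm l L) xs \<eta> \<eta>' \<and> occurs_at ?Q x \<eta>' \<and>
        (\<forall>y. y \<notin> (\<lambda>i. x + of_nat i) ` {..<length ?P} \<longrightarrow> \<eta>' y = \<eta> y))"
    proof (intro exI[of _ "[x + of_nat j]"] allI impI)
      fix \<eta> assume occ: "occurs_at ?P x \<eta>"
      then have card: "L + 2 \<le> CARD('n)"
        and val: "\<And>i. i < L + 2 \<Longrightarrow> \<eta> (x + of_nat i) = ?P ! i"
        using len by (auto simp: occurs_at_def)
      have next_site: "x + of_nat j + 1 = x + of_nat (j + 1)"
        by (simp add: add_ac)
      define \<eta>' where "\<eta>' = exchange (x + of_nat j) (x + of_nat (j + 1)) \<eta>"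
      have "l \<le> window_particles L j (translate (x + of_nat j) \<eta>)"
        using window_particles_occurs_at[OF occ len jL] Pj False cnt by simp
      then have "0 < reduced_pmm l L (translate (x + of_nat j) \<eta>)"
        using jL by (intro reduced_pmm_pos)
      moreover have "\<eta> (x + of_nat j) \<noteq> \<eta> (x + of_nat (j + 1))"
        using val[of j] val[of "j + 1"] Pj False jL by auto
      ultimately have "jumps (reduced_pmm l L) [x + of_nat j] \<eta> \<eta>'"
        by (simp only: jumps.simps jump_def next_site \<eta>'_def) simp
      moreover have "occurs_at ?Q x \<eta>'"
        unfolding occurs_at_def
      proof (intro conjI allI impI)
        show "length ?Q \<le> CARD('n)"
          using card len by simp
        fix i assume "i < length ?Q"
        then have i: "i < L + 2"
          using len by simp
        have eq: "x + of_nat i = x + (of_nat k :: 'n mod_ring) \<longleftrightarrow> i = k" if "k < L + 2" for k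
          using card i that by (intro site_eq_iff) auto
        have "\<eta>' (x + of_nat i) =
            (if i = j + 1 then ?P ! j else if i = j then ?P ! (j + 1) else ?P ! i)"
          unfolding \<eta>'_def exchange_def fun_upd_apply
          using eq[of j] eq[of "j + 1"] jL val[of i] val[of j] val[of "j + 1"] i
          by (simp del: of_nat_Suc of_nat_add)
        also have "\<dots> = ?Q ! i"
          by (auto simp: j_def nth_append nth_Cons split: nat.split)
        finally show "\<eta>' (x + of_nat i) = ?Q ! i" .
      qed
      moreover have "\<eta>' y = \<eta> y" if y: "y \<notin> (\<lambda>i. x + of_nat i) ` {..<length ?P}" for y
      proof -
        have "y \<noteq> x + of_nat j" "y \<noteq> x + of_nat (j + 1)"
          using y len jL by (auto simp del: of_nat_Suc of_nat_add)
        then show ?thesis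
          by (simp add: \<eta>'_def exchange_def)
      qed
      ultimately show "\<exists>\<eta>'. jumps (reduced_pmm l L) [x + of_nat j] \<eta> \<eta>' \<and> occurs_at ?Q x \<eta>' \<and>
        (\<forall>y. y \<notin> (\<lambda>i. x + of_nat i) ` {..<length ?P} \<longrightarrow> \<eta>' y = \<eta> y)"
        by blast
    qed
  qed
qed

lemma transitions_possible_permute:
  assumes len: "length P = L + 2" "length Q = L + 2"
    and cnt: "l + 1 \<le> count_list P True" "count_list P True = count_list Q True"
  shows "transitions_possible (reduced_pmm l L :: 'n::nontriv constraint) P Q"
proof -
  \<comment> \<open>\<open>R\<close> and \<open>S\<close> range over all rearrangements of
    \<open>P\<close>, so that one statement yields both directions.\<close>
  have "transition_possible (reduced_pmm l L :: 'n constraint) R S"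
    if "mset R = mset P" "mset S = mset P" for R S
  proof (rule adjacent_swaps_mset[where M = "mset P"])
    fix A u v B assume *: "mset (A @ [u, v] @ B) = mset P"
    have "l + 1 \<le> count_list (A @ [u, v] @ B) True"
      using cnt(1) * by (metis count_mset)
    moreover have "length (A @ [u, v] @ B) = L + 2"
      using len(1) * by (metis size_mset)
    ultimately show "transition_possible (reduced_pmm l L :: 'n constraint)
        (A @ [u, v] @ B) (A @ [v, u] @ B)"
      by (intro transition_possible_swap)
  qed (use that in \<open>auto intro: transition_possible_refl transition_possible_trans\<close>)
  moreover have "mset Q = mset P"
    using assms by (intro mset_bool_eqI) auto
  ultimately show ?thesis
    by (simp add: transitions_possible_def)
qed

lemma mobile_cluster_reduced_pmm:
  assumes len: "length B = L + 2"
    and particles: "l + 1 \<le> count_list B True" and hole: "1 \<le> count_list B False"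
  shows "mobile_cluster (reduced_pmm l L :: 'n::nontriv constraint) B"
proof -
  let ?T = "transitions_possible (reduced_pmm l L :: 'n constraint)"
  \<comment> \<open>\<open>C\<close> keeps all particles of \<open>B\<close> on \<open>L + 1\<close>
    sites; the removed hole can be parked at either end of it.\<close>
  define C where "C = remove1 False B"
  have "False \<in> set B"
    using hole count_notin[of False B] by fastforce
  then have lenC: "length C = L + 1"
    using len by (simp add: C_def length_remove1)
  have cntC: "count_list C True = count_list B True"
    unfolding C_def by (induction B) auto
  have BC: "?T B (False # C)" "?T B (C @ [False])"
    using len lenC cntC particles by (auto intro!: transitions_possible_permute)
  obtain w D where wD: "C = w # D"
    using lenC by (cases C) auto
  obtain D' w' where Dw: "C = D' @ [w']"
    using lenC by (cases C rule: rev_cases) auto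
  \<comment> \<open>\<open>D\<close> and \<open>D'\<close> have length \<open>L\<close>, so either
    one plus a two-site node is again a box. Dropping an end of \<open>C\<close> costs at most one
    of \<open>l + 1\<close> particles, and the particle in the node makes up for it.\<close>
  have cntD: "l \<le> count_list D True" "l \<le> count_list D' True"
  proof -
    show "l \<le> count_list D True"
      using cntC particles by (simp add: wD split: if_splits)
    show "l \<le> count_list D' True"
      using cntC particles by (simp add: Dw split: if_splits)
  qed

  \<comment> \<open>The hole goes to the left end, the particle crosses \<open>C\<close> and then
    the hole, and the hole and \<open>C\<close> are turned back into \<open>B\<close>.\<close>
  have "?T (B @ [True]) ([True] @ B)"
  proof -
    have "?T (B @ [True]) ((False # C) @ [True])"
      using transitions_possible_context[OF BC(1), of "[]" "[True]"] by simp
    also have "?T \<dots> ([False] @ (True # C))"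
      using transitions_possible_context[OF transitions_possible_permute, of "C @ [True]" L "True # C" l "[False]" "[]"]
        lenC cntC particles by simp
    also have "?T \<dots> ([True] @ (False # C))"
      using transitions_possible_context[OF transitions_possible_permute, of "[False, True] @ D'" L "[True, False] @ D'" l "[]" "[w']"]
        lenC Dw cntD by simp
    also have "?T \<dots> ([True] @ B)"
      using transitions_possible_context[OF transitions_possible_sym[OF BC(1)], of "[True]" "[]"] by simp
    finally show ?thesis .
  qed
  \<comment> \<open>With a hole parked on the left, the remaining block \<open>C @ [False]\<close>
    is itself a rearrangement of \<open>B\<close>.\<close>
  moreover have "?T (B @ [False]) ([False] @ B)"
  proof -
    have "?T (B @ [False]) ([False] @ (C @ [False]))"
      using transitions_possible_context[OF BC(1), of "[]" "[False]"] by simp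
    also have "?T \<dots> ([False] @ B)"
      using transitions_possible_context[OF transitions_possible_sym[OF BC(2)], of "[False]" "[]"] by simp
    finally show ?thesis .
  qed
  \<comment> \<open>The hole is parked away from the node and \<open>w\<close> stays put, so
    \<open>D @ [False, True]\<close> is a rich enough box. The last transition is the mirror image,
    with \<open>D'\<close>.\<close>
  moreover have "?T (B @ [False, True]) (B @ [True, False])"
  proof -
    have "?T (B @ [False, True]) ([False] @ C @ [False, True])"
      using transitions_possible_context[OF BC(1), of "[]" "[False, True]"] by simp
    also have "?T \<dots> ([False] @ C @ [True, False])"
      using transitions_possible_context[OF transitions_possible_permute, of "D @ [False, True]" L "D @ [True, False]" l "[False, w]" "[]"]
        lenC wD cntD by simp
    also have "?T \<dots> (B @ [True, False])"
      using transitions_possible_context[OF transitions_possible_sym[OF BC(1)], of "[]" "[True, False]"] by simp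
    finally show ?thesis .
  qed
  moreover have "?T ([False, True] @ B) ([True, False] @ B)"
  proof -
    have "?T ([False, True] @ B) ([False, True] @ C @ [False])"
      using transitions_possible_context[OF BC(2), of "[False, True]" "[]"] by simp
    also have "?T \<dots> ([True, False] @ C @ [False])"
      using transitions_possible_context[OF transitions_possible_permute, of "[False, True] @ D'" L "[True, False] @ D'" l "[]" "[w', False]"]
        lenC Dw cntD by simp
    also have "?T \<dots> ([True, False] @ B)"
      using transitions_possible_context[OF transitions_possible_sym[OF BC(2)], of "[True, False]" "[]"] by simp
    finally show ?thesis .
  qed
  ultimately show ?thesis
    by (simp only: mobile_cluster_def)
qed

section \<open>Range, monotonicity and interpolation\<close>

text \<open>Passing from \<open>n\<close> to \<open>n + 1\<close> multiplies the ratio by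
  \<open>(m - n) / (L - n)\<close>, at most 1 because a window holds \<open>m \<le> L\<close>
  particles.\<close>

lemma reduced_pmm_window_antimono:
  assumes "j \<le> L" and "k \<le> k'" and "k' \<le> L"
  shows "reduced_pmm_window k' L j \<eta> \<le> reduced_pmm_window k L j \<eta>"
  using assms(2,3)
proof (induction k' rule: dec_induct)
  case (step n)
  let ?m = "window_particles L j \<eta>"
  have mL: "?m \<le> L"
    using assms(1) by (rule window_particles_le)
  \<comment> \<open>Truncated subtraction is harmless: for \<open>a < n\<close> both binomials
    vanish.\<close>
  have absorb: "real (Suc n) * real (a choose Suc n) = real (a - n) * real (a choose n)" for a
    by (metis binomial_absorb_comp binomial_absorption of_nat_mult)
  have "real (?m choose Suc n) * real (L choose n) \<le> real (?m choose n) * real (L choose Suc n)"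
  proof -
    have "real (Suc n) * (real (?m choose Suc n) * real (L choose n))
        = real (?m - n) * (real (?m choose n) * real (L choose n))"
      using absorb[of ?m] by (simp add: mult.assoc)
    also have "\<dots> \<le> real (L - n) * (real (?m choose n) * real (L choose n))"
      using mL by (intro mult_right_mono) auto
    also have "\<dots> = real (Suc n) * (real (?m choose n) * real (L choose Suc n))"
      using absorb[of L] by (simp add: mult_ac)
    finally show ?thesis
      by (rule mult_left_le_imp_le) simp
  qed
  then have "reduced_pmm_window (Suc n) L j \<eta> \<le> reduced_pmm_window n L j \<eta>"
    unfolding reduced_pmm_window_eq using step.prems by (simp add: divide_simps mult_ac)
  then show ?case
    using step by simp
qed simp

lemma reduced_pmm_antimono:
  assumes "k \<le> k'" and "k' \<le> L"
  shows "reduced_pmm k' L \<eta> \<le> reduced_pmm k L \<eta>"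
  unfolding reduced_pmm_def using assms
  by (intro mult_left_mono sum_mono reduced_pmm_window_antimono) auto

text \<open>The top of the monotone family, which gives the upper bound 1 in the range.\<close>

lemma reduced_pmm_0: "reduced_pmm 0 L \<eta> = 1"
  by (simp add: reduced_pmm_def reduced_pmm_window_def)

lemma reduced_pmm_nonneg: "0 \<le> reduced_pmm l L \<eta>"
  by (simp add: reduced_pmm_def reduced_pmm_window_nonneg sum_nonneg)

text \<open>For \<open>l = L\<close> a window contributes 1 if it is full and 0 otherwise, which is
  the product of its occupation values.\<close>

lemma reduced_pmm_eq_pmm: "(reduced_pmm L L :: 'n::nontriv constraint) = pmm L"
proof
  fix \<eta> :: "'n config"
  have win: "reduced_pmm_window L L j \<eta> = (\<Prod>i \<in> window L j. of_bool (\<eta> (of_int i)))"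
    if "j \<le> L" for j
  proof -
    let ?A = "{i \<in> window L j. \<eta> (of_int i)}"
    have "L \<le> card ?A \<longleftrightarrow> ?A = window L j"
      using card_window[OF that] card_subset_eq[of "window L j" ?A] window_particles_le[OF that, of \<eta>]
      by (auto simp: window_particles_def)
    then have "reduced_pmm_window L L j \<eta> = of_bool (\<forall>i \<in> window L j. \<eta> (of_int i))"
      using card_window[OF that] by (auto simp: reduced_pmm_window_def window_particles_def)
    also have "\<dots> = (\<Prod>i \<in> window L j. of_bool (\<eta> (of_int i)))"
      by (simp add: prod_of_bool)
    finally show ?thesis .
  qed
  have "(\<Sum>j = 0..L. reduced_pmm_window L L j \<eta>)
      = (\<Sum>j = 0..L. \<Prod>i \<in> window L j. of_bool (\<eta> (of_int i)))"
    using win by (intro sum.cong) auto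
  \<comment> \<open>\<open>window L (L + 1 - j)\<close> is the index set of term \<open>j\<close> in
    \<open>pmm\<close>: both averages list the same windows, in opposite order.\<close>
  also have "\<dots> = (\<Sum>j = 1..L + 1. \<Prod>i \<in> window L (L + 1 - j). of_bool (\<eta> (of_int i)))"
    by (rule sum.reindex_bij_witness[of _ "\<lambda>j. L + 1 - j" "\<lambda>j. L + 1 - j"]) auto
  also have "\<dots> = (\<Sum>j = 1..L + 1.
      \<Prod>i \<in> {- (int L + 1) + int j..int j} - {0, 1}. of_bool (\<eta> (of_int i)))"
    by (intro sum.cong prod.cong) (auto simp: window_def of_nat_diff)
  finally show "reduced_pmm L L \<eta> = pmm L \<eta>"
    by (simp add: reduced_pmm_def pmm_def)
qed

lemma blocked_empty:
  assumes "1 \<le> l"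
  shows "blocked (reduced_pmm l L) (\<lambda>_. False)"
  using assms
  by (simp add: blocked_def reduced_pmm_def reduced_pmm_window_def window_particles_def translate_def)

section \<open>Equilibrium expectation\<close>

lemma product_prob_space_measure_pmf: "product_prob_space (\<lambda>_. measure_pmf p)"
  by unfold_locales

text \<open>The indicator is a product of one-site functions, with factor 1 off \<open>A\<close> so
  that it runs over the whole torus; the product measure then factorises the integral.\<close>

lemma
  fixes A :: "'n::nontriv mod_ring set"
  assumes \<rho>: "\<rho> \<in> {0..1}"
  shows integrable_bernoulli_occupied:
      "integrable (bernoulli_measure \<rho>) (\<lambda>\<eta>. of_bool (\<forall>x \<in> A. \<eta> x) :: real)"
    and integral_bernoulli_occupied:
      "(\<integral>\<eta>. of_bool (\<forall>x \<in> A. \<eta> x) \<partial>bernoulli_measure \<rho>) = \<rho> ^ card A"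
proof -
  interpret product_prob_space "\<lambda>_ :: 'n mod_ring. measure_pmf (bernoulli_pmf \<rho>)" UNIV
    by (rule product_prob_space_measure_pmf)
  let ?f = "\<lambda>x b. of_bool (x \<in> A \<longrightarrow> b) :: real"
  have int: "integrable (measure_pmf (bernoulli_pmf \<rho>)) (?f x)" for x
    by (rule integrable_measure_pmf_finite) simp
  have eq: "(of_bool (\<forall>x \<in> A. \<eta> x) :: real) = (\<Prod>x \<in> UNIV. ?f x (\<eta> x))" for \<eta>
    by (auto simp: prod_of_bool)
  show "integrable (bernoulli_measure \<rho>) (\<lambda>\<eta>. of_bool (\<forall>x \<in> A. \<eta> x) :: real)"
    unfolding bernoulli_measure_def eq by (rule product_integrable_prod) (use int in auto)
  have "(\<integral>\<eta>. of_bool (\<forall>x \<in> A. \<eta> x) \<partial>bernoulli_measure \<rho>)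
      = (\<Prod>x \<in> UNIV. \<integral>b. ?f x b \<partial>measure_pmf (bernoulli_pmf \<rho>))"
    unfolding bernoulli_measure_def eq by (rule product_integral_prod) (use int in auto)
  \<comment> \<open>\<open>bernoulli_pmf\<close> clamps its parameter to the unit interval, which
    leaves this \<rho> as it is.\<close>
  also have "\<dots> = (\<Prod>x \<in> UNIV. if x \<in> A then \<rho> else 1)"
    using \<rho> by (intro prod.cong) auto
  also have "\<dots> = \<rho> ^ card A"
    by (simp add: prod.If_cases)
  finally show "(\<integral>\<eta>. of_bool (\<forall>x \<in> A. \<eta> x) \<partial>bernoulli_measure \<rho>) = \<rho> ^ card A" .
qed

lemma choose_window_particles:
  "real (window_particles L j \<eta> choose l)
    = (\<Sum>S \<in> {S. S \<subseteq> window L j \<and> card S = l}. of_bool (\<forall>x \<in> of_int ` S. \<eta> x))"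
proof -
  let ?P = "{i \<in> window L j. \<eta> (of_int i)}"
  have "window_particles L j \<eta> choose l = card {S. S \<subseteq> ?P \<and> card S = l}"
    by (simp add: window_particles_def n_subsets)
  also have "{S. S \<subseteq> ?P \<and> card S = l}
      = {S. S \<subseteq> window L j \<and> card S = l} \<inter> {S. \<forall>x \<in> of_int ` S. \<eta> x}"
    by auto
  finally show ?thesis
    by simp
qed

text \<open>When \<open>N = L + 1\<close>, the end points \<open>-j\<close> and \<open>-j + L + 1\<close> of a window are the same site. This
  does no harm if \<open>l \<le> 1\<close>, because then only single occupation values are averaged.\<close>

lemma inj_on_window_subset:
  assumes "L + 2 \<le> CARD('n::nontriv) \<or> card S \<le> 1" and "S \<subseteq> window L j"
  shows "inj_on (of_int :: int \<Rightarrow> 'n mod_ring) S"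
  using assms(1)
proof
  assume "L + 2 \<le> CARD('n)"
  then have "inj_on (of_int :: int \<Rightarrow> 'n mod_ring) {- int j..- int j + int L + 1}"
    by (intro inj_on_of_int_mod_ring) auto
  then show ?thesis
    by (rule inj_on_subset) (use assms(2) in \<open>auto simp: window_def\<close>)
next
  assume "card S \<le> 1"
  moreover have "finite S"
    using assms(2) finite_window finite_subset by blast
  ultimately show ?thesis
    by (metis One_nat_def card_le_Suc0_iff_eq inj_onI)
qed

text \<open>By linearity each \<open>l\<close>-subset of the window contributes
  \<open>\<rho> ^ l\<close>; there are \<open>L choose l\<close> of them, which cancels the
  normalisation.\<close>

lemma
  fixes \<rho> :: real
  assumes \<rho>: "\<rho> \<in> {0..1}" and j: "j \<le> L" and l: "l \<le> L"
    and N: "L + 2 \<le> CARD('n::nontriv) \<or> l \<le> 1"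
  shows integrable_reduced_pmm_window: "integrable (bernoulli_measure \<rho>)
      (reduced_pmm_window l L j :: 'n constraint)"
    and integral_reduced_pmm_window:
      "(\<integral>\<eta>. (reduced_pmm_window l L j :: 'n constraint) \<eta> \<partial>bernoulli_measure \<rho>) = \<rho> ^ l"
proof -
  let ?\<S> = "{S. S \<subseteq> window L j \<and> card S = l}"
  have eq: "reduced_pmm_window l L j = (\<lambda>\<eta> :: 'n config.
      (\<Sum>S \<in> ?\<S>. of_bool (\<forall>x \<in> of_int ` S. \<eta> x)) / real (L choose l))"
    by (rule ext) (simp only: reduced_pmm_window_eq choose_window_particles)
  show "integrable (bernoulli_measure \<rho>) (reduced_pmm_window l L j :: 'n constraint)"
    unfolding eq
    by (intro integrable_divide Bochner_Integration.integrable_sum integrable_bernoulli_occupied[OF \<rho>])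
  have "(\<integral>\<eta>. (reduced_pmm_window l L j :: 'n constraint) \<eta> \<partial>bernoulli_measure \<rho>)
      = (\<Sum>S \<in> ?\<S>. \<rho> ^ card (of_int ` S :: 'n mod_ring set)) / real (L choose l)"
    unfolding eq integral_divide_zero
    by (subst Bochner_Integration.integral_sum)
      (simp_all only: integrable_bernoulli_occupied[OF \<rho>] integral_bernoulli_occupied[OF \<rho>])
  \<comment> \<open>Injectivity puts \<open>S\<close> on \<open>l\<close> different sites; two
    indices on one site would give a lower power.\<close>
  also have "(\<Sum>S \<in> ?\<S>. \<rho> ^ card (of_int ` S :: 'n mod_ring set)) = (\<Sum>S \<in> ?\<S>. \<rho> ^ l)"
  proof (rule sum.cong)
    fix S assume S: "S \<in> ?\<S>"
    then have "inj_on (of_int :: int \<Rightarrow> 'n mod_ring) S"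
      using N by (intro inj_on_window_subset) auto
    then show "\<rho> ^ card (of_int ` S :: 'n mod_ring set) = \<rho> ^ l"
      using S by (simp add: card_image)
  qed simp
  also have "\<dots> / real (L choose l) = \<rho> ^ l"
    using l j by (simp add: n_subsets card_window)
  finally show "(\<integral>\<eta>. (reduced_pmm_window l L j :: 'n constraint) \<eta> \<partial>bernoulli_measure \<rho>) = \<rho> ^ l" .
qed

lemma integral_reduced_pmm:
  fixes \<rho> :: real
  assumes "\<rho> \<in> {0..1}" and "l \<le> L" and "L + 2 \<le> CARD('n::nontriv) \<or> l \<le> 1"
  shows "(\<integral>\<eta>. (reduced_pmm l L :: 'n constraint) \<eta> \<partial>bernoulli_measure \<rho>) = \<rho> ^ l"
proof -
  have "(\<integral>\<eta>. (\<Sum>j = 0..L. (reduced_pmm_window l L j :: 'n constraint) \<eta>) \<partial>bernoulli_measure \<rho>)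
      = (\<Sum>j = 0..L. \<rho> ^ l)"
    using assms
    by (subst Bochner_Integration.integral_sum)
      (auto simp: integrable_reduced_pmm_window integral_reduced_pmm_window)
  then show ?thesis
    unfolding reduced_pmm_def integral_mult_right_zero by (simp add: field_simps)
qed

text \<open>Both guards matter. For \<open>l = 0\<close> the constraint is constantly 1, so nothing
  is blocked. If \<open>CARD('n) = L + 1\<close> and \<open>l \<ge> 2\<close>,
  \<open>window L 1\<close> contains -1 and \<open>L\<close>, which are the same site;
  \<open>l\<close>-subsets with both contribute \<open>\<rho> ^ (l - 1)\<close>, and the mean
  exceeds \<open>\<rho> ^ l\<close> for \<open>0 < \<rho> < 1\<close>.\<close>

theorem proposition2p9:
  fixes L l :: nat
  assumes "1 \<le> L" and "L < CARD('n::nontriv)" and "l \<le> L"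
  shows
    \<comment> \<open>(i) mobile clusters\<close>
    "(\<forall>B. length B = L + 2 \<and> l + 1 \<le> count_list B True \<and> 1 \<le> count_list B False \<longrightarrow>
        mobile_cluster (reduced_pmm l L :: 'n constraint) B) \<and>
     \<comment> \<open>(ii) blocked configurations\<close>
     (1 \<le> l \<longrightarrow> (\<exists>\<eta>. blocked (reduced_pmm l L :: 'n constraint) \<eta>)) \<and>
     \<comment> \<open>(iii) interpolation\<close>
     (reduced_pmm L L :: 'n constraint) = pmm L \<and>
     \<comment> \<open>(iv) range\<close>
     (\<forall>\<eta>. (reduced_pmm l L :: 'n constraint) \<eta> \<in> {0..1}) \<and>
     \<comment> \<open>(v) monotonicity\<close>
     antimono_on {0..L} (\<lambda>k. reduced_pmm k L :: 'n constraint) \<and>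
     \<comment> \<open>(vi) equilibrium expected value\<close>
     (L + 2 \<le> CARD('n) \<or> l \<le> 1 \<longrightarrow>
       (\<forall>\<rho>\<in>{0..1}. (\<integral>\<eta>. (reduced_pmm l L :: 'n constraint) \<eta> \<partial>bernoulli_measure \<rho>) = \<rho> ^ l))"
proof (intro conjI allI impI ballI)
  fix B assume "length B = L + 2 \<and> l + 1 \<le> count_list B True \<and> 1 \<le> count_list B False"
  then show "mobile_cluster (reduced_pmm l L :: 'n constraint) B"
    using mobile_cluster_reduced_pmm by blast
next
  assume "1 \<le> l"
  then show "\<exists>\<eta>. blocked (reduced_pmm l L :: 'n constraint) \<eta>"
    using blocked_empty by blast
next
  show "(reduced_pmm L L :: 'n constraint) = pmm L"
    by (rule reduced_pmm_eq_pmm)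
next
  fix \<eta> :: "'n config"
  show "reduced_pmm l L \<eta> \<in> {0..1}"
    using reduced_pmm_antimono[of 0 l L \<eta>] \<open>l \<le> L\<close> by (simp add: reduced_pmm_0 reduced_pmm_nonneg)
next
  show "antimono_on {0..L} (\<lambda>k. reduced_pmm k L :: 'n constraint)"
    by (auto intro!: monotone_onI le_funI reduced_pmm_antimono)
next
  fix \<rho> :: real assume "L + 2 \<le> CARD('n) \<or> l \<le> 1" and "\<rho> \<in> {0..1}"
  then show "(\<integral>\<eta>. (reduced_pmm l L :: 'n constraint) \<eta> \<partial>bernoulli_measure \<rho>) = \<rho> ^ l"
    using \<open>l \<le> L\<close> by (intro integral_reduced_pmm)
qed

end
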